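(* Let $n\geq 1$, $d\geq 3$ and $k\geq 1$ be integers such that $k\leq \frac{d}{2}-1$. Then for a generic homogeneous polynomial $f\in S_{n,d}$ (that is, for every $f$ in some nonempty Zariski open subset of $S_{n,d}$ depending only on $n,d,k$) the following holds: if $g\in S_{n,d}$ is any homogeneous polynomial with $E_k(f)=E_k(g)$, then $g\in\mathbb{C}^*f$, i.e. $g=cf$ for some nonzero $c\in\mathbb{C}$.
   Context: $S_{n,d}$ denotes the complex vector space of homogeneous polynomials of degree $d$ (including $0$) in $\mathbb{C}[x_0,x_1,\dots,x_n]$. For a multi-index $I=(i_0,\dots,i_n)\in\mathbb{N}^{n+1}$ with $|I|=i_0+\cdots+i_n$, write $D_If=\frac{\partial^{|I|}f}{\partial x_0^{i_0}\cdots\partial x_n^{i_n}}$. For $f\in S_{n,d}$ and an integer $k\geq 0$, $E_k(f)=\langle D_If : |I|=k\rangle$ is the complex vector space spanned by all $k$-th order partial derivatives of $f$; it is a subspace of $S_{n,d-k}$. *)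

theory Defs
  imports Complex_Main "HOL-Library.Poly_Mapping"
begin

text \<open>
  Complex polynomials in variables indexed by \<open>'v\<close> are the monoid algebra of the exponent
  vectors \<open>'v \<Rightarrow>\<^sub>0 nat\<close> over \<open>complex\<close>; \<open>lookup p m\<close> is the coefficient of the monomial \<open>x^m\<close>.
\<close>

type_synonym 'v cpoly = "('v \<Rightarrow>\<^sub>0 nat) \<Rightarrow>\<^sub>0 complex"

definition cpoly_vars :: "'v cpoly \<Rightarrow> 'v set" where
  "cpoly_vars p = (\<Union>m\<in>Poly_Mapping.keys p. Poly_Mapping.keys m)"

definition cpoly_eval :: "('v \<Rightarrow> complex) \<Rightarrow> 'v cpoly \<Rightarrow> complex" where
  "cpoly_eval a p = (\<Sum>m\<in>Poly_Mapping.keys p.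
    Poly_Mapping.lookup p m * (\<Prod>v\<in>Poly_Mapping.keys m. a v ^ Poly_Mapping.lookup m v))"

text \<open>Scalar multiplication is multiplication by the constant polynomial \<open>c\<close>.\<close>

definition cpoly_scale :: "complex \<Rightarrow> 'v cpoly \<Rightarrow> 'v cpoly" where
  "cpoly_scale c p = Poly_Mapping.single 0 c * p"

interpretation cpoly: vector_space "cpoly_scale :: complex \<Rightarrow> 'v cpoly \<Rightarrow> 'v cpoly"
  by unfold_locales
    (simp_all add: cpoly_scale_def algebra_simps single_add mult_single flip: mult.assoc)

text \<open>The multi-indices \<open>I = (i\<^sub>0, \<dots>, i\<^sub>n)\<close> with \<open>\<bar>I\<bar> = k\<close>.\<close>

definition multi_indices :: "nat \<Rightarrow> nat \<Rightarrow> (nat \<Rightarrow>\<^sub>0 nat) set" where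
  "multi_indices n k = {I. Poly_Mapping.keys I \<subseteq> {0..n} \<and> (\<Sum>i=0..n. Poly_Mapping.lookup I i) = k}"

definition homogeneous_polys :: "nat \<Rightarrow> nat \<Rightarrow> nat cpoly set" where
  "homogeneous_polys n d = {f. Poly_Mapping.keys f \<subseteq> multi_indices n d}"

text \<open>
  Termwise \<open>\<partial>/\<partial>x\<^sub>i (c x^m) = c m\<^sub>i x^(m - e\<^sub>i)\<close>. If \<open>m\<^sub>i = 0\<close>, the subtraction truncates
  but the coefficient vanishes.
\<close>

definition partial_deriv :: "nat \<Rightarrow> nat cpoly \<Rightarrow> nat cpoly" where
  "partial_deriv i p =
    (\<Sum>m\<in>Poly_Mapping.keys p. Poly_Mapping.single (m - Poly_Mapping.single i 1)
      (of_nat (Poly_Mapping.lookup m i) * Poly_Mapping.lookup p m))"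

definition multi_deriv :: "nat \<Rightarrow> (nat \<Rightarrow>\<^sub>0 nat) \<Rightarrow> nat cpoly \<Rightarrow> nat cpoly" where
  "multi_deriv n I f = foldr (\<lambda>i. partial_deriv i ^^ Poly_Mapping.lookup I i) [0..<Suc n] f"

definition deriv_space :: "nat \<Rightarrow> nat \<Rightarrow> nat cpoly \<Rightarrow> nat cpoly set" where
  "deriv_space n k f = cpoly.span {multi_deriv n I f | I. I \<in> multi_indices n k}"

text \<open>
  The Zariski topology on \<open>S\<^sub>n\<^sub>,\<^sub>d\<close>, viewed as the affine space whose coordinates are the
  coefficients: the coordinate ring is the polynomial ring in variables indexed by the exponent
  vectors of degree \<open>d\<close>, and the point \<open>f\<close> has coordinates \<open>lookup f\<close>.
\<close>

definition zariski_closed_in :: "nat \<Rightarrow> nat \<Rightarrow> nat cpoly set \<Rightarrow> bool" where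
  "zariski_closed_in n d Z \<longleftrightarrow>
    (\<exists>P :: (nat \<Rightarrow>\<^sub>0 nat) cpoly set.
       (\<forall>p\<in>P. cpoly_vars p \<subseteq> multi_indices n d) \<and>
       Z = {f \<in> homogeneous_polys n d. \<forall>p\<in>P. cpoly_eval (Poly_Mapping.lookup f) p = 0})"

definition zariski_open_in :: "nat \<Rightarrow> nat \<Rightarrow> nat cpoly set \<Rightarrow> bool" where
  "zariski_open_in n d U \<longleftrightarrow>
    U \<subseteq> homogeneous_polys n d \<and> zariski_closed_in n d (homogeneous_polys n d - U)"

end

theory Submission
  imports Defs "Jordan_Normal_Form.Determinant"
begin

text \<open>
  Let \<open>f\<close> be such that no nonzero differential operator of order \<open>k + 1\<close> annihilates it. If
  \<open>E\<^sub>k(f) = E\<^sub>k(g)\<close>, then \<open>D\<^sub>I g = \<phi>\<^sub>I f\<close> for operators \<open>\<phi>\<^sub>I\<close> of order \<open>k\<close>, and comparing the two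
  ways of differentiating once more gives \<open>\<partial>\<^sub>j \<phi>\<^bsub>I + e\<^sub>i\<^esub> = \<partial>\<^sub>i \<phi>\<^bsub>I + e\<^sub>j\<^esub>\<close>. As there are at least two variables,
  this forces \<open>\<phi>\<^sub>I = c D\<^sub>I\<close> with a constant \<open>c\<close>; all derivatives of order \<open>k \<le> d\<close> of \<open>g - c f\<close>
  vanish, so \<open>g = c f\<close>.

  The condition on \<open>f\<close> holds on the locus where a square submatrix of its catalecticant matrix
  in degrees \<open>(k + 1, d - k - 1)\<close> is invertible; such a submatrix with all
  columns exists because \<open>2 (k + 1) \<le> d\<close>. This locus is nonempty, since for suitable
  coefficients the submatrix is a rescaled Gaussian kernel matrix.
\<close>

section \<open>Evaluation and occurring variables of complex polynomials\<close>

abbreviation unit_index :: "nat \<Rightarrow> (nat \<Rightarrow>\<^sub>0 nat)" where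
  "unit_index i \<equiv> Poly_Mapping.single i (Suc 0)"

lemma poly_mapping_single_add_induct [case_names zero single_add]:
  assumes "P 0" and "\<And>a b f. P f \<Longrightarrow> P (Poly_Mapping.single a b + f)"
  shows "P f"
proof (induction f rule: update_induct)
  case (update f a b)
  have "Poly_Mapping.update a b f = Poly_Mapping.single a b + f"
    using update(1)
    by (intro poly_mapping_eqI)
      (auto simp: lookup_update lookup_add lookup_single in_keys_iff when_def)
  then show ?case using assms(2) update by metis
qed (rule assms(1))

lemma lookup_cpoly_scale [simp]:
  "Poly_Mapping.lookup (cpoly_scale c p) m = c * Poly_Mapping.lookup p m"
  unfolding cpoly_scale_def mult_map_scale_conv_mult[symmetric]
  by (simp add: Poly_Mapping.map.rep_eq when_def)

lemma cpoly_eval_add: "cpoly_eval a (p + q) = cpoly_eval a p + cpoly_eval a q"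
  unfolding cpoly_eval_def
  by (rule setsum_keys_plus_distrib) (auto simp: algebra_simps)

lemma cpoly_eval_single:
  "cpoly_eval a (Poly_Mapping.single m c) =
    c * (\<Prod>v\<in>Poly_Mapping.keys m. a v ^ Poly_Mapping.lookup m v)"
  by (simp add: cpoly_eval_def)

lemma prod_keys_add:
  fixes m m' :: "'v \<Rightarrow>\<^sub>0 nat" and a :: "'v \<Rightarrow> complex"
  shows "(\<Prod>v\<in>Poly_Mapping.keys (m + m'). a v ^ Poly_Mapping.lookup (m + m') v) =
    (\<Prod>v\<in>Poly_Mapping.keys m. a v ^ Poly_Mapping.lookup m v) *
    (\<Prod>v\<in>Poly_Mapping.keys m'. a v ^ Poly_Mapping.lookup m' v)"
proof -
  let ?K = "Poly_Mapping.keys m \<union> Poly_Mapping.keys m'"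
  have extend: "(\<Prod>v\<in>Poly_Mapping.keys p. a v ^ Poly_Mapping.lookup p v) =
      (\<Prod>v\<in>?K. a v ^ Poly_Mapping.lookup p v)" if "Poly_Mapping.keys p \<subseteq> ?K" for p
    using that by (intro prod.mono_neutral_left) (auto simp: in_keys_iff)
  show ?thesis
    unfolding extend[OF keys_add] extend[OF Un_upper1] extend[OF Un_upper2]
    by (simp add: lookup_add power_add prod.distrib)
qed

lemma cpoly_eval_mult: "cpoly_eval a (p * q) = cpoly_eval a p * cpoly_eval a q"
proof (induction p rule: poly_mapping_single_add_induct)
  case zero
  show ?case by (simp add: cpoly_eval_def)
next
  case (single_add m c p)
  have "cpoly_eval a (Poly_Mapping.single m c * q) =
      cpoly_eval a (Poly_Mapping.single m c) * cpoly_eval a q"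
  proof (induction q rule: poly_mapping_single_add_induct)
    case zero
    show ?case by (simp add: cpoly_eval_def)
  next
    case (single_add m' c' q)
    then show ?case
      by (simp add: distrib_left cpoly_eval_add mult_single cpoly_eval_single prod_keys_add)
  qed
  with single_add show ?case
    by (simp add: distrib_right cpoly_eval_add)
qed

text \<open>This lets evaluation at a coefficient vector be pulled inside a determinant with
  polynomial entries.\<close>

lemma comm_ring_hom_cpoly_eval: "comm_ring_hom (cpoly_eval a)"
proof
  show "cpoly_eval a 1 = 1"
    using cpoly_eval_single[of a 0 1] by simp
qed (auto simp: cpoly_eval_add cpoly_eval_mult cpoly_eval_def[of _ 0])

lemma cpoly_vars_0: "cpoly_vars 0 \<subseteq> V"
  and cpoly_vars_1: "cpoly_vars 1 \<subseteq> V"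
  by (auto simp: cpoly_vars_def)

lemma cpoly_vars_uminus: "cpoly_vars p \<subseteq> V \<Longrightarrow> cpoly_vars (- p) \<subseteq> V"
  by (auto simp: cpoly_vars_def in_keys_iff)

lemma cpoly_vars_add:
  "cpoly_vars p \<subseteq> V \<Longrightarrow> cpoly_vars q \<subseteq> V \<Longrightarrow> cpoly_vars (p + q) \<subseteq> V"
  using keys_add[of p q] unfolding cpoly_vars_def by blast

lemma cpoly_vars_mult:
  assumes "cpoly_vars p \<subseteq> V" "cpoly_vars q \<subseteq> V"
  shows "cpoly_vars (p * q) \<subseteq> V"
proof
  fix v assume "v \<in> cpoly_vars (p * q)"
  then obtain a b where "a \<in> Poly_Mapping.keys p" "b \<in> Poly_Mapping.keys q"
      "v \<in> Poly_Mapping.keys (a + b)"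
    using keys_mult[of p q] unfolding cpoly_vars_def by blast
  then show "v \<in> V"
    using keys_add[of a b] assms unfolding cpoly_vars_def by blast
qed

lemma cpoly_vars_sum: "(\<And>i. i \<in> A \<Longrightarrow> cpoly_vars (p i) \<subseteq> V) \<Longrightarrow> cpoly_vars (sum p A) \<subseteq> V"
  by (induction A rule: infinite_finite_induct) (simp_all add: cpoly_vars_0 cpoly_vars_add)

lemma cpoly_vars_prod: "(\<And>i. i \<in> A \<Longrightarrow> cpoly_vars (p i) \<subseteq> V) \<Longrightarrow> cpoly_vars (prod p A) \<subseteq> V"
  by (induction A rule: infinite_finite_induct) (simp_all add: cpoly_vars_1 cpoly_vars_mult)

text \<open>By the Leibniz formula a determinant is built from its entries by sums, products and
  signs. It is needed to place the defining equation of the bad locus in the coordinate ring of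
  \<open>S_{n,d}\<close>.\<close>

lemma cpoly_vars_det:
  fixes B :: "nat \<Rightarrow> nat \<Rightarrow> 'a cpoly"
  assumes "\<And>i j. i < N \<Longrightarrow> j < N \<Longrightarrow> cpoly_vars (B i j) \<subseteq> V"
  shows "cpoly_vars (det (mat N N (\<lambda>(i, j). B i j))) \<subseteq> V"
proof -
  have sgn: "cpoly_vars (signof p :: 'a cpoly) \<subseteq> V" for p
    by (simp add: sign_def cpoly_vars_1 cpoly_vars_uminus)
  have prd: "cpoly_vars (\<Prod>i = 0..<N. mat N N (\<lambda>(i, j). B i j) $$ (i, p i)) \<subseteq> V"
    if "p permutes {0..<N}" for p
    using assms permutes_in_image[OF that] by (intro cpoly_vars_prod) auto
  show ?thesis
    unfolding det_def'[OF mat_carrier]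
    by (intro cpoly_vars_sum cpoly_vars_mult sgn prd) simp
qed

section \<open>Invertibility of matrices indexed by a finite set\<close>

text \<open>The bridge between the polynomial condition and linear algebra: the enumeration
  \<open>e\<close> serves only to write down a determinant, while the kernel condition is free of
  it. One direction certifies a point of the open set, the other exploits membership in it.\<close>

lemma det_mat_bij_nonzero_iff:
  fixes B :: "'i \<Rightarrow> 'i \<Rightarrow> 'a :: field"
  assumes e: "bij_betw e {0..<N} M"
  shows "det (mat N N (\<lambda>(i, j). B (e i) (e j))) \<noteq> 0 \<longleftrightarrow>
    (\<forall>c. (\<forall>I\<in>M. (\<Sum>J\<in>M. B I J * c J) = 0) \<longrightarrow> (\<forall>J\<in>M. c J = 0))"
proof -
  let ?A = "mat N N (\<lambda>(i, j). B (e i) (e j))"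
  have row: "(?A *\<^sub>v vec N (\<lambda>j. c (e j))) $ i = (\<Sum>J\<in>M. B (e i) J * c J)" if "i < N" for c i
    using that sum.reindex_bij_betw[OF e, of "\<lambda>J. B (e i) J * c J"]
    by (simp add: scalar_prod_def)
  have inM: "e i \<in> M" if "i < N" for i
    using e that by (auto simp: bij_betw_def)
  have onto: "\<exists>i<N. I = e i" if "I \<in> M" for I
    using e that by (force simp: bij_betw_def)
  have "det ?A = 0 \<longleftrightarrow> (\<exists>v. v \<in> carrier_vec N \<and> v \<noteq> 0\<^sub>v N \<and> ?A *\<^sub>v v = 0\<^sub>v N)"
    by (rule det_0_iff_vec_prod_zero_field) simp
  also have "\<dots> \<longleftrightarrow> (\<exists>c. (\<forall>I\<in>M. (\<Sum>J\<in>M. B I J * c J) = 0) \<and> (\<exists>J\<in>M. c J \<noteq> 0))"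
  proof
    assume "\<exists>v. v \<in> carrier_vec N \<and> v \<noteq> 0\<^sub>v N \<and> ?A *\<^sub>v v = 0\<^sub>v N"
    then obtain v where v: "v \<in> carrier_vec N" "v \<noteq> 0\<^sub>v N" "?A *\<^sub>v v = 0\<^sub>v N" by blast
    define c where "c J = v $ inv_into {0..<N} e J" for J
    have c: "c (e i) = v $ i" if "i < N" for i
      using e that by (simp add: c_def bij_betw_def inv_into_f_f)
    then have vc: "vec N (\<lambda>j. c (e j)) = v" using v(1) by (intro eq_vecI) auto
    have "(\<Sum>J\<in>M. B (e i) J * c J) = 0" if "i < N" for i
      using row[OF that, of c] v(3) that unfolding vc by simp
    moreover obtain i where "i < N" "v $ i \<noteq> 0"
      using v(1,2) by (metis carrier_vecD eq_vecI index_zero_vec)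
    ultimately show "\<exists>c. (\<forall>I\<in>M. (\<Sum>J\<in>M. B I J * c J) = 0) \<and> (\<exists>J\<in>M. c J \<noteq> 0)"
      using onto inM c by metis
  next
    assume "\<exists>c. (\<forall>I\<in>M. (\<Sum>J\<in>M. B I J * c J) = 0) \<and> (\<exists>J\<in>M. c J \<noteq> 0)"
    then obtain c J where c: "\<And>I. I \<in> M \<Longrightarrow> (\<Sum>J\<in>M. B I J * c J) = 0" "J \<in> M" "c J \<noteq> 0"
      by blast
    let ?v = "vec N (\<lambda>j. c (e j))"
    have "?A *\<^sub>v ?v = 0\<^sub>v N"
      using row[of _ c] c(1) inM by (intro eq_vecI) (simp_all del: index_mult_mat_vec)
    moreover have "?v \<noteq> 0\<^sub>v N"
      using onto[OF c(2)] c(3) by (metis index_vec index_zero_vec(1))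
    ultimately show "\<exists>v. v \<in> carrier_vec N \<and> v \<noteq> 0\<^sub>v N \<and> ?A *\<^sub>v v = 0\<^sub>v N"
      by (intro exI[of _ ?v]) simp
  qed
  finally show ?thesis by blast
qed

text \<open>In the row \<open>I\<close> where \<open>norm (c I)\<close> is maximal, the off-diagonal
  terms are too small to cancel \<open>B I I * c I\<close> unless this maximum is zero.\<close>

lemma diagonally_dominant_kernel_trivial:
  fixes B :: "'i \<Rightarrow> 'i \<Rightarrow> 'a :: real_normed_field"
  assumes M: "finite M"
    and dom: "\<And>I. I \<in> M \<Longrightarrow> (\<Sum>J\<in>M - {I}. norm (B I J)) < norm (B I I)"
    and ker: "\<And>I. I \<in> M \<Longrightarrow> (\<Sum>J\<in>M. B I J * c J) = 0"
    and J: "J \<in> M"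
  shows "c J = 0"
proof -
  obtain I where I: "I \<in> M" "\<And>J. J \<in> M \<Longrightarrow> norm (c J) \<le> norm (c I)"
    using ex_is_arg_min_if_finite[OF M, of "\<lambda>J. - norm (c J)"] J
    unfolding is_arg_min_linorder neg_le_iff_le by blast
  have "B I I * c I = - (\<Sum>J\<in>M - {I}. B I J * c J)"
    using ker[OF I(1)] sum.remove[OF M I(1), of "\<lambda>J. B I J * c J"]
    by (simp add: eq_neg_iff_add_eq_0)
  then have "norm (B I I) * norm (c I) = norm (\<Sum>J\<in>M - {I}. B I J * c J)"
    by (metis norm_minus_cancel norm_mult)
  also have "\<dots> \<le> (\<Sum>J\<in>M - {I}. norm (B I J * c J))"
    by (rule norm_sum)
  also have "\<dots> \<le> (\<Sum>J\<in>M - {I}. norm (B I J) * norm (c I))"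
    using I by (intro sum_mono) (auto simp: norm_mult intro!: mult_left_mono)
  finally have "norm (B I I) * norm (c I) \<le> (\<Sum>J\<in>M - {I}. norm (B I J)) * norm (c I)"
    by (simp add: sum_distrib_right)
  with dom[OF I(1)] have "\<not> 0 < norm (c I)"
    by (meson leD mult_strict_right_mono)
  with I(2)[OF J] show ?thesis by simp
qed

section \<open>Arithmetic of multi-indices of fixed degree\<close>

lemma finite_multi_indices [simp]: "finite (multi_indices n k)"
proof -
  let ?F = "{g. \<forall>i. (i \<in> {0..n} \<longrightarrow> g i \<in> {0..k}) \<and> (i \<notin> {0..n} \<longrightarrow> g i = 0)}"
  have "Poly_Mapping.lookup ` multi_indices n k \<subseteq> ?F"
  proof clarify
    fix I :: "nat \<Rightarrow>\<^sub>0 nat" and i assume I: "I \<in> multi_indices n k"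
    have "Poly_Mapping.lookup I i \<le> k" if "i \<in> {0..n}"
      using member_le_sum[OF that, of "Poly_Mapping.lookup I"] I
      by (simp add: multi_indices_def)
    then show "(i \<in> {0..n} \<longrightarrow> Poly_Mapping.lookup I i \<in> {0..k}) \<and>
        (i \<notin> {0..n} \<longrightarrow> Poly_Mapping.lookup I i = 0)"
      using I by (auto simp: multi_indices_def in_keys_iff subset_iff)
  qed
  moreover have "finite ?F" by (rule finite_set_of_finite_funs) auto
  ultimately show ?thesis
    by (rule finite_imageD[OF finite_subset]) (auto intro: inj_onI poly_mapping_eqI)
qed

lemma multi_indices_eqI:
  assumes "I \<in> multi_indices n k" "J \<in> multi_indices n k"
    and "\<And>i. i \<in> {0..n} \<Longrightarrow> Poly_Mapping.lookup I i = Poly_Mapping.lookup J i"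
  shows "I = J"
proof (rule poly_mapping_eqI)
  fix i
  show "Poly_Mapping.lookup I i = Poly_Mapping.lookup J i"
  proof (cases "i \<in> {0..n}")
    case False
    then have "i \<notin> Poly_Mapping.keys I" "i \<notin> Poly_Mapping.keys J"
      using assms(1,2) unfolding multi_indices_def by blast+
    then show ?thesis by (simp add: in_keys_iff)
  qed (rule assms(3))
qed

lemma multi_indices_add:
  assumes "I \<in> multi_indices n a" "J \<in> multi_indices n b"
  shows "I + J \<in> multi_indices n (a + b)"
  using assms keys_add[of I J]
  by (auto simp: multi_indices_def lookup_add sum.distrib)

lemma single_in_multi_indices: "i \<le> n \<Longrightarrow> Poly_Mapping.single i k \<in> multi_indices n k"
  by (auto simp: multi_indices_def lookup_single when_def)

lemma multi_indices_add_unit: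
  "I \<in> multi_indices n k \<Longrightarrow> i \<le> n \<Longrightarrow> I + unit_index i \<in> multi_indices n (Suc k)"
  using multi_indices_add[OF _ single_in_multi_indices[of i n 1], of I k] by simp

lemma minus_unit_index_add:
  "0 < Poly_Mapping.lookup I i \<Longrightarrow> I - unit_index i + unit_index i = I"
  by (rule poly_mapping_eqI) (auto simp: lookup_add lookup_minus lookup_single when_def)

lemma unit_index_add_minus:
  "0 < Poly_Mapping.lookup I i \<Longrightarrow> unit_index i + (I - unit_index i) = I"
  using minus_unit_index_add[of I i] by (simp add: add.commute)

lemma multi_indices_minus_unit:
  assumes I: "I \<in> multi_indices n (Suc k)" and i: "0 < Poly_Mapping.lookup I i"
  shows "I - unit_index i \<in> multi_indices n k" "i \<le> n"
proof -
  show i': "i \<le> n" using I i by (auto simp: multi_indices_def in_keys_iff subset_iff)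
  have "Poly_Mapping.keys (I - unit_index i) \<subseteq> {0..n}"
    using I by (auto simp: multi_indices_def in_keys_iff subset_iff lookup_minus)
  moreover have "(\<Sum>j=0..n. Poly_Mapping.lookup (I - unit_index i + unit_index i) j) = Suc k"
    using I unfolding minus_unit_index_add[OF i] by (simp add: multi_indices_def)
  then have "(\<Sum>j=0..n. Poly_Mapping.lookup (I - unit_index i) j) = k"
    using i' unfolding lookup_add sum.distrib by (simp add: lookup_single when_def)
  ultimately show "I - unit_index i \<in> multi_indices n k"
    by (simp add: multi_indices_def)
qed

lemma multi_indices_Suc_cases:
  assumes "I \<in> multi_indices n (Suc k)"
  obtains i where "i \<le> n" "0 < Poly_Mapping.lookup I i"
proof -
  have "(\<Sum>i=0..n. Poly_Mapping.lookup I i) \<noteq> 0" using assms by (simp add: multi_indices_def)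
  then obtain i where "i \<in> {0..n}" "Poly_Mapping.lookup I i \<noteq> 0" by (meson sum.neutral)
  then show ?thesis using that by auto
qed

lemma multi_indices_split:
  assumes "I \<in> multi_indices n (a + b)"
  obtains K J where "K \<in> multi_indices n a" "J \<in> multi_indices n b" "I = K + J"
  using assms
proof (induction b arbitrary: I thesis)
  case 0
  then show ?case
    using single_in_multi_indices[of 0 n 0] by (metis add_0_right single_zero le0)
next
  case (Suc b)
  then obtain i where i: "i \<le> n" "0 < Poly_Mapping.lookup I i"
    using multi_indices_Suc_cases by (metis add_Suc_right)
  with Suc obtain K J where "K \<in> multi_indices n a" "J \<in> multi_indices n b"
      "I - unit_index i = K + J"
    by (metis add_Suc_right multi_indices_minus_unit(1))
  then show ?case
    using Suc(2)[of K "J + unit_index i"] multi_indices_add_unit i minus_unit_index_add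
    by (metis add.assoc)
qed

section \<open>Normalized coefficients and the action of derivatives\<close>

text \<open>
  With the factorials \<open>K!\<close> absorbed into the coefficients, differentiation becomes a shift
  of the coefficient sequence.
\<close>

definition multi_fact :: "nat \<Rightarrow> (nat \<Rightarrow>\<^sub>0 nat) \<Rightarrow> nat" where
  "multi_fact n K = (\<Prod>i=0..n. fact (Poly_Mapping.lookup K i))"

definition dcoeff :: "nat \<Rightarrow> nat cpoly \<Rightarrow> (nat \<Rightarrow>\<^sub>0 nat) \<Rightarrow> complex" where
  "dcoeff n f K = of_nat (multi_fact n K) * Poly_Mapping.lookup f K"

lemma multi_fact_nonzero [simp]: "multi_fact n K \<noteq> 0"
  by (simp add: multi_fact_def)

lemma dcoeff_add: "dcoeff n (f + g) K = dcoeff n f K + dcoeff n g K"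
  by (simp add: dcoeff_def lookup_add algebra_simps)

lemma dcoeff_scale: "dcoeff n (cpoly_scale c f) K = c * dcoeff n f K"
  by (simp add: dcoeff_def)

lemma dcoeff_zero [simp]: "dcoeff n 0 K = 0"
  by (simp add: dcoeff_def)

lemma lookup_partial_deriv:
  "Poly_Mapping.lookup (partial_deriv i p) K =
    of_nat (Suc (Poly_Mapping.lookup K i)) * Poly_Mapping.lookup p (K + unit_index i)"
proof -
  have "Poly_Mapping.lookup (partial_deriv i p) K =
      (\<Sum>m\<in>Poly_Mapping.keys p. of_nat (Poly_Mapping.lookup m i) * Poly_Mapping.lookup p m
        when m - unit_index i = K)"
    by (simp add: partial_deriv_def lookup_sum lookup_single)
  also have "\<dots> = (\<Sum>m\<in>Poly_Mapping.keys p. if K + unit_index i = m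
      then of_nat (Poly_Mapping.lookup m i) * Poly_Mapping.lookup p m else 0)"
  \<comment> \<open>The two conditions differ only if \<open>m\<close> has exponent 0 at
    \<open>i\<close>: truncated subtraction then allows \<open>m = K\<close>, but the factor coming
    from that exponent is 0.\<close>
  proof (rule sum.cong[OF refl])
    fix m
    show "(of_nat (Poly_Mapping.lookup m i) * Poly_Mapping.lookup p m when m - unit_index i = K) =
      (if K + unit_index i = m then of_nat (Poly_Mapping.lookup m i) * Poly_Mapping.lookup p m
       else 0)"
      using minus_unit_index_add[of m i] by (cases "Poly_Mapping.lookup m i = 0") (auto simp: when_def)
  qed
  also have "\<dots> = of_nat (Suc (Poly_Mapping.lookup K i)) * Poly_Mapping.lookup p (K + unit_index i)"
    by (simp add: lookup_add in_keys_iff)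
  finally show ?thesis .
qed

lemma dcoeff_partial_deriv:
  assumes "i \<le> n"
  shows "dcoeff n (partial_deriv i f) K = dcoeff n f (K + unit_index i)"
proof -
  have "multi_fact n (K + unit_index i) = Suc (Poly_Mapping.lookup K i) * multi_fact n K"
  proof -
    have "(\<Prod>j\<in>{0..n} - {i}. fact (Poly_Mapping.lookup (K + unit_index i) j)) =
        (\<Prod>j\<in>{0..n} - {i}. fact (Poly_Mapping.lookup K j) :: nat)"
      by (rule prod.cong) (auto simp: lookup_add lookup_single)
    then show ?thesis
      using assms unfolding multi_fact_def
      by (simp add: prod.remove[of _ i] lookup_add algebra_simps)
  qed
  then show ?thesis by (simp add: dcoeff_def lookup_partial_deriv algebra_simps)
qed

lemma dcoeff_partial_deriv_power:
  "i \<le> n \<Longrightarrow> dcoeff n ((partial_deriv i ^^ r) f) K = dcoeff n f (K + Poly_Mapping.single i r)"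
proof (induction r arbitrary: K)
  case (Suc r)
  have "Poly_Mapping.single i (Suc r) = unit_index i + Poly_Mapping.single i r"
    by (simp flip: single_add)
  with Suc show ?case
    by (simp add: dcoeff_partial_deriv add.assoc)
qed simp

lemma dcoeff_multi_deriv:
  assumes I: "Poly_Mapping.keys I \<subseteq> {0..n}"
  shows "dcoeff n (multi_deriv n I f) K = dcoeff n f (K + I)"
proof -
  have shift: "dcoeff n (foldr (\<lambda>i. partial_deriv i ^^ Poly_Mapping.lookup I i) xs f) K =
      dcoeff n f (K + (\<Sum>i\<leftarrow>xs. Poly_Mapping.single i (Poly_Mapping.lookup I i)))"
    if "set xs \<subseteq> {0..n}" for xs
    using that
    by (induction xs arbitrary: K) (simp_all add: dcoeff_partial_deriv_power add.assoc)
  have "(\<Sum>i\<leftarrow>[0..<Suc n]. Poly_Mapping.single i (Poly_Mapping.lookup I i)) = I"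
  proof (rule poly_mapping_eqI)
    fix j
    have "Poly_Mapping.lookup (\<Sum>i\<leftarrow>[0..<Suc n]. Poly_Mapping.single i (Poly_Mapping.lookup I i)) j
        = (\<Sum>i\<in>{0..<Suc n}. if i = j then Poly_Mapping.lookup I i else 0)"
      unfolding interv_sum_list_conv_sum_set_nat set_upt lookup_sum lookup_single when_def ..
    also have "\<dots> = Poly_Mapping.lookup I j"
      using I by (auto simp: in_keys_iff subset_iff simp del: sum.op_ivl_Suc)
    finally show "Poly_Mapping.lookup
        (\<Sum>i\<leftarrow>[0..<Suc n]. Poly_Mapping.single i (Poly_Mapping.lookup I i)) j =
        Poly_Mapping.lookup I j" .
  qed
  then show ?thesis
    using shift[of "[0..<Suc n]"] by (simp add: multi_deriv_def atLeastLessThanSuc_atLeastAtMost del: upt_Suc)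
qed

text \<open>The vector \<open>c\<close> consists of the coefficients of a constant-coefficient
  operator of order \<open>k\<close> that takes \<open>f\<close> to \<open>p\<close>; hence it is
  the same for every \<open>K\<close>.\<close>

lemma dcoeff_deriv_space:
  assumes "p \<in> deriv_space n k f"
  shows "\<exists>c. \<forall>K. dcoeff n p K = (\<Sum>J\<in>multi_indices n k. c J * dcoeff n f (K + J))"
  using assms unfolding deriv_space_def
proof (induction rule: cpoly.span_induct)
  case base
  show ?case
  proof (rule cpoly.subspaceI; clarsimp)
    show "\<exists>c. \<forall>K. (\<Sum>J\<in>multi_indices n k. c J * dcoeff n f (K + J)) = 0"
      by (rule exI[of _ "\<lambda>_. 0"]) simp
  next
    fix p q c c'
    assume "\<forall>K. dcoeff n p K = (\<Sum>J\<in>multi_indices n k. c J * dcoeff n f (K + J))"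
      and "\<forall>K. dcoeff n q K = (\<Sum>J\<in>multi_indices n k. c' J * dcoeff n f (K + J))"
    then show "\<exists>c. \<forall>K. dcoeff n (p + q) K = (\<Sum>J\<in>multi_indices n k. c J * dcoeff n f (K + J))"
      by (intro exI[of _ "\<lambda>J. c J + c' J"]) (simp add: dcoeff_add distrib_right sum.distrib)
  next
    fix p b c
    assume "\<forall>K. dcoeff n p K = (\<Sum>J\<in>multi_indices n k. c J * dcoeff n f (K + J))"
    then show "\<exists>c. \<forall>K. dcoeff n (cpoly_scale b p) K =
        (\<Sum>J\<in>multi_indices n k. c J * dcoeff n f (K + J))"
      by (intro exI[of _ "\<lambda>J. b * c J"]) (simp add: dcoeff_scale sum_distrib_left mult.assoc)
  qed
next
  case (step p)
  then obtain I where I: "p = multi_deriv n I f" "I \<in> multi_indices n k" by blast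
  have "dcoeff n p K = (\<Sum>J\<in>multi_indices n k. (if J = I then 1 else 0) * dcoeff n f (K + J))" for K
  proof -
    have "(\<Sum>J\<in>multi_indices n k. (if J = I then 1 else 0) * dcoeff n f (K + J)) =
        (\<Sum>J\<in>multi_indices n k. if J = I then dcoeff n f (K + J) else 0)"
      by (rule sum.cong) auto
    also have "\<dots> = dcoeff n p K"
      using I dcoeff_multi_deriv[of I n f K] by (auto simp: multi_indices_def[of n k, THEN eqset_imp_iff])
    finally show ?thesis ..
  qed
  then show ?case by (intro exI[of _ "\<lambda>J. if J = I then 1 else 0"] allI)
qed

section \<open>Catalecticants and recovery of a form from its derivative space\<close>

text \<open>For \<open>a = dcoeff n f\<close> with \<open>f\<close> of degree \<open>b + j\<close>,
  the sums over \<open>J\<close> are the normalized coefficients of the operator \<open>c\<close> of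
  order \<open>j\<close> applied to \<open>f\<close>, so this says that no nonzero such operator
  annihilates \<open>f\<close>.\<close>

definition catalecticant_injective ::
  "nat \<Rightarrow> nat \<Rightarrow> nat \<Rightarrow> ((nat \<Rightarrow>\<^sub>0 nat) \<Rightarrow> complex) \<Rightarrow> bool" where
  "catalecticant_injective n j b a \<longleftrightarrow>
    (\<forall>c. (\<forall>K\<in>multi_indices n b. (\<Sum>J\<in>multi_indices n j. c J * a (K + J)) = 0) \<longrightarrow>
      (\<forall>J\<in>multi_indices n j. c J = 0))"

text \<open>Contracting \<open>a\<close> with \<open>x\<^sub>j h\<close> is contracting the shift of \<open>a\<close> by \<open>e\<^sub>j\<close> with \<open>h\<close>.\<close>

lemma contraction_shift:
  assumes "j \<le> n"
  shows "(\<Sum>T\<in>multi_indices n (Suc k).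
      (if 0 < Poly_Mapping.lookup T j then h (T - unit_index j) else 0) * a (K + T)) =
    (\<Sum>J\<in>multi_indices n k. h J * (a (K + unit_index j + J) :: complex))"
proof -
  have "(\<Sum>T\<in>multi_indices n (Suc k).
      (if 0 < Poly_Mapping.lookup T j then h (T - unit_index j) else 0) * a (K + T)) =
    (\<Sum>T\<in>{T\<in>multi_indices n (Suc k). 0 < Poly_Mapping.lookup T j}.
      h (T - unit_index j) * a (K + T))"
    by (rule sum.mono_neutral_cong_right) auto
  also have "\<dots> = (\<Sum>J\<in>multi_indices n k. h J * a (K + unit_index j + J))"
    using assms
    by (intro sum.reindex_bij_witness[of _ "\<lambda>J. J + unit_index j" "\<lambda>T. T - unit_index j"])
      (auto simp: minus_unit_index_add unit_index_add_minus multi_indices_minus_unit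
        multi_indices_add_unit lookup_add add.assoc)
  finally show ?thesis .
qed

text \<open>
  The hypotheses say \<open>x\<^sub>j \<phi> (I + e\<^sub>i) = x\<^sub>i \<phi> (I + e\<^sub>j)\<close>, read off coefficientwise; the
  conclusion says \<open>\<phi> I = c x^I\<close>.
\<close>

lemma exchange_imp_scalar:
  fixes \<phi> :: "(nat \<Rightarrow>\<^sub>0 nat) \<Rightarrow> (nat \<Rightarrow>\<^sub>0 nat) \<Rightarrow> complex"
  assumes n: "n \<ge> 1"
    and exchange: "\<And>I L i j. I \<in> multi_indices n k \<Longrightarrow> L \<in> multi_indices n k \<Longrightarrow> i \<le> n \<Longrightarrow> j \<le> n \<Longrightarrow>
      i \<noteq> j \<Longrightarrow> \<phi> (I + unit_index i) (L + unit_index i) = \<phi> (I + unit_index j) (L + unit_index j)"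
    and vanish: "\<And>I L i. I \<in> multi_indices n k \<Longrightarrow> L \<in> multi_indices n (Suc k) \<Longrightarrow> i \<le> n \<Longrightarrow>
      Poly_Mapping.lookup L i = 0 \<Longrightarrow> \<phi> (I + unit_index i) L = 0"
  shows "\<exists>c. \<forall>I\<in>multi_indices n (Suc k). \<forall>J\<in>multi_indices n (Suc k).
    \<phi> I J = (if I = J then c else 0)"
proof -
  \<comment> \<open>A second variable exists because \<open>n \<ge> 1\<close>; every exchange below
    needs one.\<close>
  have other: "\<exists>j\<le>n. i \<noteq> j" for i
    using n by (cases "i = 0") (auto intro: exI[of _ 0] exI[of _ 1])
  have move: "\<phi> I J = \<phi> (I - unit_index i + unit_index j) (J - unit_index i + unit_index j)"
    if "I \<in> multi_indices n (Suc k)" "J \<in> multi_indices n (Suc k)" "0 < Poly_Mapping.lookup I i"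
      "0 < Poly_Mapping.lookup J i" "j \<le> n" "i \<noteq> j" for I J i j
    using exchange[of "I - unit_index i" "J - unit_index i" i j] that
    by (simp add: multi_indices_minus_unit minus_unit_index_add)
  have mem: "I - unit_index i + unit_index j \<in> multi_indices n (Suc k)"
    if "I \<in> multi_indices n (Suc k)" "0 < Poly_Mapping.lookup I i" "j \<le> n" for I i j
    using that by (intro multi_indices_add_unit multi_indices_minus_unit(1))
  \<comment> \<open>Moving a unit from \<open>i\<close> to another variable lowers both exponents at
    \<open>i\<close> by one and keeps the strict inequality. Once \<open>J\<close> has exponent 0 at
    \<open>i\<close>, \<open>vanish\<close> applies.\<close>
  have less: "\<phi> I J = 0"
    if "I \<in> multi_indices n (Suc k)" "J \<in> multi_indices n (Suc k)"
      "Poly_Mapping.lookup J i < Poly_Mapping.lookup I i" for I J i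
    using that
  proof (induction "Poly_Mapping.lookup J i" arbitrary: I J)
    case 0
    then show ?case
      using vanish[of "I - unit_index i" J i]
      by (simp add: multi_indices_minus_unit minus_unit_index_add)
  next
    case (Suc l)
    obtain j where j: "j \<le> n" "i \<noteq> j" using other by blast
    have pos: "0 < Poly_Mapping.lookup I i" "0 < Poly_Mapping.lookup J i" using Suc by auto
    have "\<phi> (I - unit_index i + unit_index j) (J - unit_index i + unit_index j) = 0"
      using Suc.hyps(2) Suc.prems j pos
      by (intro Suc.hyps(1) mem)
        (auto simp: lookup_add lookup_minus lookup_single)
    then show ?case using move[OF Suc.prems(1,2) pos j] by simp
  qed
  \<comment> \<open>By \<open>less\<close>, a nonzero entry forces \<open>I \<le> J\<close> in every
    variable; the equal total degrees then force \<open>I = J\<close>.\<close>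
  have off_diagonal: "\<phi> I J = 0"
    if IJ: "I \<in> multi_indices n (Suc k)" "J \<in> multi_indices n (Suc k)" "I \<noteq> J" for I J
  proof (rule ccontr)
    assume "\<phi> I J \<noteq> 0"
    then have le: "Poly_Mapping.lookup I i \<le> Poly_Mapping.lookup J i" for i
      using less[OF IJ(1,2), of i] by linarith
    have eq: "Poly_Mapping.lookup I i = Poly_Mapping.lookup J i" if "i \<in> {0..n}" for i
    proof (rule ccontr)
      assume "Poly_Mapping.lookup I i \<noteq> Poly_Mapping.lookup J i"
      then have "Poly_Mapping.lookup I i < Poly_Mapping.lookup J i" using le[of i] by simp
      then have "(\<Sum>i=0..n. Poly_Mapping.lookup I i) < (\<Sum>i=0..n. Poly_Mapping.lookup J i)"
        using le that by (intro sum_strict_mono_ex1) blast+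
      then show False using IJ by (simp add: multi_indices_def)
    qed
    have "I = J" using IJ(1,2) eq by (rule multi_indices_eqI)
    with IJ show False by simp
  qed
  \<comment> \<open>The constant is read off at the pure power of variable 0; moving units to
    variable 0 one at a time connects every diagonal entry to it.\<close>
  define I\<^sub>0 where "I\<^sub>0 = Poly_Mapping.single (0::nat) (Suc k)"
  have diagonal: "\<phi> I I = \<phi> I\<^sub>0 I\<^sub>0" if "I \<in> multi_indices n (Suc k)" for I
    using that
  proof (induction "Suc k - Poly_Mapping.lookup I 0" arbitrary: I)
    case 0
    have "(\<Sum>i=0..n. Poly_Mapping.lookup I i) =
        Poly_Mapping.lookup I 0 + (\<Sum>i\<in>{0..n} - {0}. Poly_Mapping.lookup I i)"
      by (rule sum.remove) auto
    moreover have "(\<Sum>i=0..n. Poly_Mapping.lookup I i) = Suc k" "Suc k \<le> Poly_Mapping.lookup I 0"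
      using 0 by (auto simp: multi_indices_def)
    ultimately have "Poly_Mapping.lookup I 0 = Suc k"
        "(\<Sum>i\<in>{0..n} - {0}. Poly_Mapping.lookup I i) = 0"
      by linarith+
    then have "I = I\<^sub>0"
      unfolding I\<^sub>0_def
      by (intro multi_indices_eqI[OF 0(2) single_in_multi_indices])
        (auto simp: lookup_single when_def)
    then show ?case by simp
  next
    case (Suc l)
    have "\<exists>i\<in>{0..n} - {0}. Poly_Mapping.lookup I i \<noteq> 0"
    proof (rule ccontr)
      assume "\<not> (\<exists>i\<in>{0..n} - {0}. Poly_Mapping.lookup I i \<noteq> 0)"
      then have "(\<Sum>i=0..n. Poly_Mapping.lookup I i) = Poly_Mapping.lookup I 0"
        by (subst sum.remove[of _ 0]) auto
      then show False using Suc by (simp add: multi_indices_def)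
    qed
    then obtain i where "i \<in> {0..n} - {0}" "Poly_Mapping.lookup I i \<noteq> 0" by blast
    then have i: "i \<le> n" "i \<noteq> 0" "0 < Poly_Mapping.lookup I i" by auto
    have "\<phi> I I = \<phi> (I - unit_index i + unit_index 0) (I - unit_index i + unit_index 0)"
      using move[OF Suc.prems Suc.prems i(3) i(3), of 0] i by simp
    also have "\<dots> = \<phi> I\<^sub>0 I\<^sub>0"
      using Suc i
      by (intro Suc.hyps(1) mem)
        (auto simp: lookup_add lookup_minus lookup_single)
    finally show ?case .
  qed
  show ?thesis
    using off_diagonal diagonal by (intro exI[of _ "\<phi> I\<^sub>0 I\<^sub>0"]) auto
qed

text \<open>Here \<open>Suc k\<close> is the order of the derivatives, so the operators that must
  not annihilate \<open>f\<close> have order \<open>Suc (Suc k)\<close>, and \<open>b\<close> is the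
  degree left after applying them.\<close>

lemma deriv_space_eq_imp_proportional:
  assumes n: "n \<ge> 1"
    and f: "f \<in> homogeneous_polys n (b + Suc (Suc k))"
    and g: "g \<in> homogeneous_polys n (b + Suc (Suc k))"
    and inj: "catalecticant_injective n (Suc (Suc k)) b (dcoeff n f)"
    and eq: "deriv_space n (Suc k) f = deriv_space n (Suc k) g"
  shows "\<exists>c. c \<noteq> 0 \<and> g = cpoly_scale c f"
proof -
  \<comment> \<open>Stated for arbitrary \<open>p\<close> and \<open>q\<close>, since it is used in
    both directions: to express \<open>g\<close> through \<open>f\<close>, and at the end
    \<open>f\<close> through \<open>g\<close>.\<close>
  have shifts: "\<exists>\<phi>. \<forall>I\<in>multi_indices n (Suc k). \<forall>K.
      dcoeff n q (K + I) = (\<Sum>J\<in>multi_indices n (Suc k). \<phi> I J * dcoeff n p (K + J))"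
    if "deriv_space n (Suc k) q = deriv_space n (Suc k) p" for p q
  proof (rule bchoice, rule ballI)
    fix I assume I: "I \<in> multi_indices n (Suc k)"
    then have "multi_deriv n I q \<in> deriv_space n (Suc k) q"
      unfolding deriv_space_def by (auto intro: cpoly.span_base)
    then have "multi_deriv n I q \<in> deriv_space n (Suc k) p"
      unfolding that .
    from dcoeff_deriv_space[OF this] show "\<exists>\<phi>. \<forall>K.
        dcoeff n q (K + I) = (\<Sum>J\<in>multi_indices n (Suc k). \<phi> J * dcoeff n p (K + J))"
      using I by (simp add: dcoeff_multi_deriv multi_indices_def)
  qed
  have inj': "c J = 0" if "\<And>K. (\<Sum>J\<in>multi_indices n (Suc (Suc k)). c J * dcoeff n f (K + J)) = 0"
      "J \<in> multi_indices n (Suc (Suc k))" for c J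
    using inj that unfolding catalecticant_injective_def by blast
  obtain \<phi> where \<phi>: "\<And>I K. I \<in> multi_indices n (Suc k) \<Longrightarrow>
      dcoeff n g (K + I) = (\<Sum>J\<in>multi_indices n (Suc k). \<phi> I J * dcoeff n f (K + J))"
    using shifts[OF eq[symmetric]] by blast
  \<comment> \<open>The two sides are the coefficients at \<open>T\<close> of
    \<open>x_j \<phi> (I + e_i)\<close> and \<open>x_i \<phi> (I + e_j)\<close>. Both operators take
    \<open>f\<close> to the derivative of \<open>g\<close> along \<open>I + e_i + e_j\<close>, so
    their difference annihilates \<open>f\<close> and is zero by injectivity.\<close>
  have syzygy: "(if 0 < Poly_Mapping.lookup T j then \<phi> (I + unit_index i) (T - unit_index j) else 0) =
      (if 0 < Poly_Mapping.lookup T i then \<phi> (I + unit_index j) (T - unit_index i) else 0)"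
    if I: "I \<in> multi_indices n k" and ij: "i \<le> n" "j \<le> n"
      and T: "T \<in> multi_indices n (Suc (Suc k))" for I i j T
  proof -
    let ?c = "\<lambda>i j T. if 0 < Poly_Mapping.lookup T j then \<phi> (I + unit_index i) (T - unit_index j) else 0"
    have contract: "(\<Sum>T\<in>multi_indices n (Suc (Suc k)). ?c i j T * dcoeff n f (K + T)) =
        dcoeff n g (K + unit_index j + (I + unit_index i))" if "i \<le> n" "j \<le> n" for i j K
      using contraction_shift[OF that(2), where h = "\<phi> (I + unit_index i)" and k = "Suc k"]
        \<phi>[OF multi_indices_add_unit[OF I that(1)]] by simp
    have "(\<Sum>T\<in>multi_indices n (Suc (Suc k)). (?c i j T - ?c j i T) * dcoeff n f (K + T)) = 0" for K
      unfolding left_diff_distrib sum_subtractf contract[OF ij] contract[OF ij(2,1)]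
      by (simp add: add_ac)
    from inj'[of "\<lambda>T. ?c i j T - ?c j i T", OF this T] have "?c i j T - ?c j i T = 0" .
    then show ?thesis by simp
  qed
  have "\<exists>c. \<forall>I\<in>multi_indices n (Suc k). \<forall>J\<in>multi_indices n (Suc k). \<phi> I J = (if I = J then c else 0)"
  \<comment> \<open>The exchange hypothesis is \<open>syzygy\<close> at
    \<open>T = L + e_i + e_j\<close>. The vanishing hypothesis is \<open>syzygy\<close> at
    \<open>T = L + e_j\<close>, which is not divisible by \<open>x_i\<close>.\<close>
  proof (rule exchange_imp_scalar[OF n])
    fix I L :: "nat \<Rightarrow>\<^sub>0 nat" and i j
    assume "I \<in> multi_indices n k" "L \<in> multi_indices n k" "i \<le> n" "j \<le> n" "i \<noteq> j"
    moreover have "L + unit_index i + unit_index j - unit_index i = L + unit_index j"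
      by (metis add.commute add.left_commute add_diff_cancel_left')
    ultimately show "\<phi> (I + unit_index i) (L + unit_index i) = \<phi> (I + unit_index j) (L + unit_index j)"
      using syzygy[of I i j "L + unit_index i + unit_index j"]
      by (simp add: multi_indices_add_unit lookup_add)
  next
    fix I L :: "nat \<Rightarrow>\<^sub>0 nat" and i
    assume *: "I \<in> multi_indices n k" "L \<in> multi_indices n (Suc k)" "i \<le> n"
      "Poly_Mapping.lookup L i = 0"
    obtain j where "j \<le> n" "j \<noteq> i"
      using n by (cases "i = 0") (auto intro: that[of 0] that[of 1])
    then show "\<phi> (I + unit_index i) L = 0"
      using syzygy[of I i j "L + unit_index j"] *
      by (simp add: multi_indices_add_unit lookup_add lookup_single)
  qed
  then obtain c where c: "\<And>I J. I \<in> multi_indices n (Suc k) \<Longrightarrow> J \<in> multi_indices n (Suc k) \<Longrightarrow>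
      \<phi> I J = (if I = J then c else 0)" by blast
  have gf: "dcoeff n g (K + I) = c * dcoeff n f (K + I)" if "I \<in> multi_indices n (Suc k)" for K I
  proof -
    have "dcoeff n g (K + I) =
        (\<Sum>J\<in>multi_indices n (Suc k). if I = J then c * dcoeff n f (K + J) else 0)"
      unfolding \<phi>[OF that] using c[OF that] by (intro sum.cong) auto
    then show ?thesis using that by simp
  qed
  have "g = cpoly_scale c f"
  proof (rule poly_mapping_eqI)
    fix T
    show "Poly_Mapping.lookup g T = Poly_Mapping.lookup (cpoly_scale c f) T"
    proof (cases "T \<in> multi_indices n (b + Suc (Suc k))")
      case True
      \<comment> \<open>The degree is regrouped so that \<open>T\<close> splits off a multi-index of
        order \<open>Suc k\<close>, where \<open>gf\<close> applies.\<close>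
      then have "T \<in> multi_indices n (Suc b + Suc k)" by simp
      then obtain K I where "I \<in> multi_indices n (Suc k)" "T = K + I"
        by (rule multi_indices_split)
      then show ?thesis using gf[of I K] by (simp add: dcoeff_def mult.left_commute)
    next
      case False
      then have "T \<notin> Poly_Mapping.keys f" "T \<notin> Poly_Mapping.keys g"
        using f g unfolding homogeneous_polys_def by blast+
      then show ?thesis by (simp add: in_keys_iff)
    qed
  qed
  \<comment> \<open>If \<open>c = 0\<close>, then \<open>g = 0\<close> and all derivatives of
    \<open>f\<close> of order \<open>Suc k\<close> vanish, hence also those of the next order. The
    operator with all coefficients 1 then annihilates \<open>f\<close>, against injectivity.\<close>
  moreover have "c \<noteq> 0"
  proof
    assume "c = 0"
    with \<open>g = cpoly_scale c f\<close> have "g = 0" by (intro poly_mapping_eqI) simp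
    then have f0: "dcoeff n f (K + I) = 0" if "I \<in> multi_indices n (Suc k)" for K I
      using shifts[OF eq] that by auto
    have "dcoeff n f (K + J) = 0" if "J \<in> multi_indices n (Suc (Suc k))" for K J
    proof -
      have "J \<in> multi_indices n (1 + Suc k)" using that by simp
      then obtain K' I where "I \<in> multi_indices n (Suc k)" "J = K' + I"
        by (rule multi_indices_split)
      then show ?thesis using f0[of I "K + K'"] by (simp add: add.assoc)
    qed
    then have "(\<Sum>J\<in>multi_indices n (Suc (Suc k)). 1 * dcoeff n f (K + J)) = 0" for K by simp
    from inj'[of "\<lambda>_. 1", OF this single_in_multi_indices[of 0]] show False by simp
  qed
  ultimately show ?thesis by blast
qed

section \<open>A Gaussian witness for nondegeneracy\<close>

text \<open>
  The parallelogram law gives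
  \<open>\<bar>I + J + v\<bar>\<^sup>2 = 2 \<bar>I + v/2\<bar>\<^sup>2 + 2 \<bar>J + v/2\<bar>\<^sup>2 - \<bar>I - J\<bar>\<^sup>2\<close>, so up to scaling rows and columns the
  matrix \<open>exp (N \<bar>I + J + v\<bar>\<^sup>2)\<close> is the Gaussian kernel \<open>exp (- N \<bar>I - J\<bar>\<^sup>2)\<close>, which is
  diagonally dominant for large \<open>N\<close>.
\<close>

lemma gaussian_kernel_trivial:
  fixes n j :: nat and v :: "nat \<Rightarrow>\<^sub>0 nat" and c :: "(nat \<Rightarrow>\<^sub>0 nat) \<Rightarrow> complex"
  defines "M \<equiv> multi_indices n j"
  defines "a \<equiv> \<lambda>K. complex_of_real (exp (real (card M) * (\<Sum>i=0..n. (real (Poly_Mapping.lookup K i))\<^sup>2)))"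
  assumes ker: "\<And>I. I \<in> M \<Longrightarrow> (\<Sum>J\<in>M. a (I + J + v) * c J) = 0"
    and J: "J \<in> M"
  shows "c J = 0"
proof -
  let ?N = "real (card M)"
  let ?l = "\<lambda>I i. real (Poly_Mapping.lookup I i)"
  define E where "E I = exp (?N * (\<Sum>i=0..n. 2 * (?l I i + ?l v i / 2)\<^sup>2))" for I
  define B where "B I J = exp (- (?N * (\<Sum>i=0..n. (?l I i - ?l J i)\<^sup>2)))" for I J
  have M: "finite M" by (simp add: M_def)
  have factor: "a (I + J + v) = of_real (E I) * of_real (B I J) * of_real (E J)" for I J
  proof -
    have "(\<Sum>i=0..n. (?l (I + J + v) i)\<^sup>2) =
        (\<Sum>i=0..n. 2 * (?l I i + ?l v i / 2)\<^sup>2 + 2 * (?l J i + ?l v i / 2)\<^sup>2 - (?l I i - ?l J i)\<^sup>2)"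
      by (rule sum.cong) (auto simp: lookup_add power2_eq_square field_simps)
    also have "\<dots> = (\<Sum>i=0..n. 2 * (?l I i + ?l v i / 2)\<^sup>2) +
        (\<Sum>i=0..n. 2 * (?l J i + ?l v i / 2)\<^sup>2) - (\<Sum>i=0..n. (?l I i - ?l J i)\<^sup>2)"
      by (simp only: sum.distrib sum_subtractf)
    finally have "?N * (\<Sum>i=0..n. (?l (I + J + v) i)\<^sup>2) =
        ?N * (\<Sum>i=0..n. 2 * (?l I i + ?l v i / 2)\<^sup>2) + - (?N * (\<Sum>i=0..n. (?l I i - ?l J i)\<^sup>2)) +
        ?N * (\<Sum>i=0..n. 2 * (?l J i + ?l v i / 2)\<^sup>2)"
      by (simp only: ring_distribs)
    then show ?thesis unfolding a_def E_def B_def by (simp only: exp_add of_real_mult)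
  qed
  \<comment> \<open>Distinct multi-indices differ by at least 1 in some entry, so their squared
    distance is at least 1.\<close>
  have off: "B I J \<le> exp (- ?N)" if IJ: "I \<in> M" "J \<in> M" "I \<noteq> J" for I J
  proof -
    obtain i where i: "Poly_Mapping.lookup I i \<noteq> Poly_Mapping.lookup J i" "i \<in> {0..n}"
      using IJ multi_indices_eqI[of I n j J] unfolding M_def by blast
    have "\<bar>int (Poly_Mapping.lookup I i) - int (Poly_Mapping.lookup J i)\<bar> \<ge> 1" using i(1) by linarith
    then have "\<bar>?l I i - ?l J i\<bar> \<ge> 1" by linarith
    then have "1 \<le> (?l I i - ?l J i)\<^sup>2" by (metis one_le_power power2_abs)
    also have "\<dots> \<le> (\<Sum>i=0..n. (?l I i - ?l J i)\<^sup>2)"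
      by (rule member_le_sum[OF i(2)]) auto
    finally have "?N * 1 \<le> ?N * (\<Sum>i=0..n. (?l I i - ?l J i)\<^sup>2)" by (intro mult_left_mono) auto
    then show ?thesis unfolding B_def by simp
  qed
  \<comment> \<open>The column factors are absorbed into the unknown vector, and the nonzero row
    factor is cancelled from each equation.\<close>
  have "of_real (E J) * c J = 0"
  proof (rule diagonally_dominant_kernel_trivial[OF M, of "\<lambda>I J. of_real (B I J)"])
    fix I assume I: "I \<in> M"
    have "(\<Sum>J\<in>M. a (I + J + v) * c J) =
        of_real (E I) * (\<Sum>J\<in>M. of_real (B I J) * (of_real (E J) * c J))"
      unfolding factor by (simp add: sum_distrib_left mult.assoc)
    then show "(\<Sum>J\<in>M. of_real (B I J) * (of_real (E J) * c J)) = 0"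
      using ker[OF I] by (simp add: E_def)
    \<comment> \<open>The choice \<open>N = card M\<close> pays off here: at most \<open>N\<close>
      off-diagonal entries, each at most \<open>exp (- N)\<close>, sum to less than the diagonal
      entry 1.\<close>
    have "(\<Sum>J\<in>M - {I}. norm (complex_of_real (B I J))) \<le> (\<Sum>J\<in>M - {I}. exp (- ?N))"
      using off[OF I] by (intro sum_mono) (auto simp: B_def)
    also have "\<dots> \<le> ?N * exp (- ?N)"
      using M by (auto intro!: mult_right_mono simp: card_Diff_subset_Int)
    also have "\<dots> < 1"
    proof -
      have "?N < exp ?N" using exp_ge_add_one_self[of ?N] by linarith
      then show ?thesis by (simp add: exp_minus field_simps)
    qed
    finally show "(\<Sum>J\<in>M - {I}. norm (complex_of_real (B I J))) < norm (complex_of_real (B I I))"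
      by (simp add: B_def)
  qed (rule J)
  then show ?thesis by (simp add: E_def)
qed

section \<open>The generic locus as the nonvanishing of one catalecticant minor\<close>

theorem theorem1p1:
  fixes n d k :: nat
  assumes "n \<ge> 1" and "d \<ge> 3" and "k \<ge> 1" and "real k \<le> real d / 2 - 1"
  shows "\<exists>U. zariski_open_in n d U \<and> U \<noteq> {} \<and>
    (\<forall>f\<in>U. \<forall>g\<in>homogeneous_polys n d.
       deriv_space n k f = deriv_space n k g \<longrightarrow> (\<exists>c. c \<noteq> 0 \<and> g = cpoly_scale c f))"
proof -
  obtain k' where k': "k = Suc k'" using assms(3) by (cases k) auto
  define j where "j = Suc k"
  have "real (2 * j) \<le> real d" using assms(4) unfolding j_def by (simp add: field_simps)
  then have "2 * j \<le> d" by (simp only: of_nat_le_iff)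
  define r where "r = d - 2 * j"
  have d: "d = (j + r) + j" using \<open>2 * j \<le> d\<close> by (simp add: r_def)
  \<comment> \<open>The shift \<open>v\<close> pads the row indices \<open>I + v\<close> to degree
    \<open>j + r = d - j\<close>. Letting \<open>I\<close> range over \<open>M\<close> selects a
    square submatrix with all columns of the catalecticant.\<close>
  define v where "v = Poly_Mapping.single (0::nat) r"
  define M where "M = multi_indices n j"
  have Md: "I + J + v \<in> multi_indices n d" if "I \<in> M" "J \<in> M" for I J
    using multi_indices_add[OF multi_indices_add[OF that[unfolded M_def]]
        single_in_multi_indices[of 0 n r]] d by (simp add: v_def add_ac)
  obtain e where e: "bij_betw e {0..<card M} M"
    using ex_bij_betw_nat_finite[of M] by (auto simp: M_def)
  have eM: "e i \<in> M" if "i < card M" for i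
    using e that by (auto simp: bij_betw_def)
  \<comment> \<open>The inner \<open>single\<close> is the coordinate variable of the coefficient at
    \<open>e i + e i' + v\<close>; the factorial turns its value at \<open>f\<close> into
    \<open>dcoeff\<close>.\<close>
  define P :: "(nat \<Rightarrow>\<^sub>0 nat) cpoly" where
    "P = det (mat (card M) (card M) (\<lambda>(i, i').
      Poly_Mapping.single (Poly_Mapping.single (e i + e i' + v) 1)
        (of_nat (multi_fact n (e i + e i' + v)))))"
  have P_vars: "cpoly_vars P \<subseteq> multi_indices n d"
    unfolding P_def by (rule cpoly_vars_det) (auto simp: cpoly_vars_def eM Md)
  have P_eval: "cpoly_eval (Poly_Mapping.lookup f) P =
      det (mat (card M) (card M) (\<lambda>(i, i'). dcoeff n f (e i + e i' + v)))" for f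
  proof -
    interpret comm_ring_hom "cpoly_eval (Poly_Mapping.lookup f)" by (rule comm_ring_hom_cpoly_eval)
    show ?thesis
      unfolding P_def hom_det[symmetric]
      by (rule arg_cong[of _ _ det], rule eq_matI) (auto simp: cpoly_eval_single dcoeff_def)
  qed
  note P_nonzero = det_mat_bij_nonzero_iff[OF e, of "\<lambda>I J. dcoeff n f (I + J + v)" for f,
      folded P_eval]
  define U where
    "U = {f \<in> homogeneous_polys n d. cpoly_eval (Poly_Mapping.lookup f) P \<noteq> 0}"
  have "zariski_open_in n d U"
    unfolding zariski_open_in_def zariski_closed_in_def
    using P_vars by (intro conjI exI[of _ "{P}"]) (auto simp: U_def)
  moreover have "U \<noteq> {}"
  proof -
    define a where "a K = complex_of_real
      (exp (real (card M) * (\<Sum>i=0..n. (real (Poly_Mapping.lookup K i))\<^sup>2)))" for K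
    \<comment> \<open>Dividing by the factorials makes the normalized coefficients of
      \<open>f\<close> in degree \<open>d\<close> equal to the Gaussian weights
      \<open>a\<close>.\<close>
    define f where "f = (\<Sum>K\<in>multi_indices n d.
      Poly_Mapping.single K (a K / of_nat (multi_fact n K)))"
    have lookup_f: "Poly_Mapping.lookup f K =
        (if K \<in> multi_indices n d then a K / of_nat (multi_fact n K) else 0)" for K
      by (simp add: f_def lookup_sum lookup_single when_def)
    then have "f \<in> homogeneous_polys n d"
      by (auto simp: homogeneous_polys_def in_keys_iff split: if_splits)
    moreover have "cpoly_eval (Poly_Mapping.lookup f) P \<noteq> 0"
      unfolding P_nonzero
    proof (intro allI impI ballI)
      fix c J
      assume "\<forall>I\<in>M. (\<Sum>J\<in>M. dcoeff n f (I + J + v) * c J) = 0" and J: "J \<in> M"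
      then have "(\<Sum>J\<in>M. a (I + J + v) * c J) = 0" if "I \<in> M" for I
        using that Md by (simp add: dcoeff_def lookup_f cong: sum.cong)
      then show "c J = 0"
        using gaussian_kernel_trivial[of n j v c J] J unfolding a_def M_def by blast
    qed
    ultimately show ?thesis by (auto simp: U_def)
  qed
  moreover have "\<exists>c. c \<noteq> 0 \<and> g = cpoly_scale c f"
    if f: "f \<in> U" and g: "g \<in> homogeneous_polys n d"
      and eq: "deriv_space n k f = deriv_space n k g" for f g
  proof (rule deriv_space_eq_imp_proportional[OF assms(1)])
    show "catalecticant_injective n (Suc (Suc k')) (j + r) (dcoeff n f)"
      unfolding catalecticant_injective_def
    proof (intro allI impI)
      fix c
      assume c: "\<forall>K\<in>multi_indices n (j + r).
        (\<Sum>J\<in>multi_indices n (Suc (Suc k')). c J * dcoeff n f (K + J)) = 0"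
      \<comment> \<open>The rows \<open>K = I + v\<close> alone already force \<open>c\<close> to
        vanish on \<open>M\<close>, since the minor is nonzero.\<close>
      have "(\<Sum>J\<in>M. dcoeff n f (I + J + v) * c J) = 0" if "I \<in> M" for I
        using c[rule_format, of "I + v"] multi_indices_add[OF that[unfolded M_def]
            single_in_multi_indices[of 0 n r]]
        by (simp add: v_def M_def j_def k' add_ac mult.commute)
      then show "\<forall>J\<in>multi_indices n (Suc (Suc k')). c J = 0"
        using f unfolding U_def mem_Collect_eq P_nonzero by (auto simp: M_def j_def k')
    qed
  qed (use f g eq d in \<open>auto simp: U_def j_def k'\<close>)
  ultimately show ?thesis by blast
qed

end
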